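(* Let $A_1, A_2, A_3$ be complex square matrices of the same size, and let $\alpha\ge 0$ be a real number with $\|A_j\|\le \alpha/3$ for $j=1,2,3$. Then for every integer $n\ge 1$, $$\left\| \left\{ \exp[A_1/n]\,\exp[A_2/n]\,\exp[A_3/n] \right\}^n - \exp\left[ \langle A\rangle \right] \right\| \le \frac{a}{n},$$ where $$\langle A\rangle = A_1 + A_2 + A_3,\qquad a = \alpha^2\,\exp[2\alpha].$$
   Context: $\exp$ denotes the matrix exponential. $\|\cdot\|$ denotes a submultiplicative matrix norm with $\|I\|=1$ for the identity matrix $I$ (e.g. an operator norm). *)

theory Defs
  imports "HOL-Analysis.Analysis"
begin

text \<open>The library's \<open>*\<close>, \<open>1\<close> and \<open>^\<close> on \<open>'a^'n^'n\<close> are componentwise, so that powers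
  and the exponential of a matrix have to be defined from \<open>**\<close> and \<open>mat 1\<close>.\<close>

primrec matrix_power :: "'a::semiring_1^'n^'n \<Rightarrow> nat \<Rightarrow> 'a^'n^'n" where
  "matrix_power A 0 = mat 1"
| "matrix_power A (Suc k) = A ** matrix_power A k"

definition matrix_exp :: "complex^'n^'n \<Rightarrow> complex^'n^'n" where
  "matrix_exp A = (\<Sum>k. (1 / fact k) *\<^sub>R matrix_power A k)"

text \<open>The limit is taken in the standard topology of \<open>complex^'n^'n\<close>, which is the topology
  of every norm on this finite-dimensional space.  The series always converges:\<close>

lemma norm_matrix_power_entry:
  fixes A :: "complex^'n^'n"
  shows "norm (matrix_power A k $ i $ j) \<le> (real CARD('n) * norm A) ^ k"
proof (induction k arbitrary: i)
  case 0
  show ?case by (simp add: mat_def)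
next
  case (Suc k)
  have "norm (A $ i $ l * matrix_power A k $ l $ j) \<le> norm A * (real CARD('n) * norm A) ^ k" for l
  proof -
    have "norm (A $ i $ l) \<le> norm A"
      by (rule order_trans[OF Finite_Cartesian_Product.norm_nth_le Finite_Cartesian_Product.norm_nth_le])
    then show ?thesis
      unfolding norm_mult by (rule mult_mono[OF _ Suc.IH]) auto
  qed
  then have "norm (\<Sum>l\<in>UNIV. A $ i $ l * matrix_power A k $ l $ j)
      \<le> of_nat (card (UNIV :: 'n set)) * (norm A * (real CARD('n) * norm A) ^ k)"
    by (intro sum_norm_bound) auto
  then show ?case
    by (simp add: matrix_matrix_mult_def mult.assoc)
qed

lemma summable_matrix_exp:
  fixes A :: "complex^'n^'n"
  shows "summable (\<lambda>k. (1 / fact k) *\<^sub>R matrix_power A k)"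
proof (rule summable_comparison_test')
  define b where "b = real CARD('n) * norm A"
  show "summable (\<lambda>k. (real CARD('n) * real CARD('n)) * (inverse (fact k) * b ^ k))"
    by (intro summable_mult summable_exp)
  fix k :: nat
  have "norm (matrix_power A k) \<le> (\<Sum>i\<in>UNIV. norm (matrix_power A k $ i))"
    unfolding norm_vec_def[of "matrix_power A k"] by (rule L2_set_le_sum) simp
  also have "\<dots> \<le> (\<Sum>i\<in>(UNIV::'n set). \<Sum>j\<in>(UNIV::'n set). norm (matrix_power A k $ i $ j))"
    by (intro sum_mono) (simp add: norm_vec_def L2_set_le_sum)
  also have "\<dots> \<le> (\<Sum>i\<in>(UNIV::'n set). \<Sum>j\<in>(UNIV::'n set). b ^ k)"
    unfolding b_def by (intro sum_mono norm_matrix_power_entry)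
  finally have "norm (matrix_power A k) \<le> (real CARD('n) * real CARD('n)) * b ^ k"
    by simp
  then show "norm ((1 / fact k) *\<^sub>R matrix_power A k)
      \<le> (real CARD('n) * real CARD('n)) * (inverse (fact k) * b ^ k)"
    by (simp add: field_simps)
qed

definition submultiplicative_matrix_norm :: "(complex^'n^'n \<Rightarrow> real) \<Rightarrow> bool" where
  "submultiplicative_matrix_norm N \<longleftrightarrow>
     (\<forall>A. 0 \<le> N A) \<and>
     (\<forall>A. N A = 0 \<longleftrightarrow> A = 0) \<and>
     (\<forall>c A. N (map_matrix ((*) c) A) = norm c * N A) \<and>
     (\<forall>A B. N (A + B) \<le> N A + N B) \<and>
     (\<forall>A B. N (A ** B) \<le> N A * N B) \<and>
     N (mat 1) = 1"

end

theory Submission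
  imports Defs
begin

text \<open>Put \<open>B\<^sub>j = A\<^sub>j / n\<close>, \<open>X = exp B\<^sub>1 exp B\<^sub>2 exp B\<^sub>3\<close>, \<open>Y = exp (B\<^sub>1 + B\<^sub>2 + B\<^sub>3)\<close> and \<open>t = \<alpha> / n\<close>.
  Both \<open>X\<close> and \<open>Y\<close> agree with \<open>1 + B\<^sub>1 + B\<^sub>2 + B\<^sub>3\<close> to first order, and their remainders are
  dominated by the scalar remainder \<open>exp t - 1 - t \<le> t\<^sup>2 exp t / 2\<close>, so \<open>N (X - Y) \<le> t\<^sup>2 exp t\<close>.
  As \<open>N X, N Y \<le> exp t\<close>, telescoping \<open>X\<^sup>n - Y\<^sup>n\<close> gives
  \<open>N (X\<^sup>n - Y\<^sup>n) \<le> n exp ((n - 1) t) t\<^sup>2 exp t = \<alpha>\<^sup>2 exp \<alpha> / n\<close>, and \<open>Y\<^sup>n = exp (A\<^sub>1 + A\<^sub>2 + A\<^sub>3)\<close>.\<close>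

section \<open>Powers and exponentials of matrices\<close>

lemma scaleR_matrix_mult:
  fixes A B :: "complex^'n^'n"
  shows "(r *\<^sub>R A) ** B = r *\<^sub>R (A ** B)" "A ** (r *\<^sub>R B) = r *\<^sub>R (A ** B)"
  by (simp_all add: scalar_matrix_assoc matrix_scalar_ac)

lemma matrix_mult_diff:
  fixes A B C :: "complex^'n^'n"
  shows "(A - B) ** C = A ** C - B ** C" "C ** (A - B) = C ** A - C ** B"
  by (simp_all add: vec_eq_iff matrix_matrix_mult_def algebra_simps sum_subtractf)

lemma matrix_power_scaleR:
  fixes A :: "complex^'n^'n"
  shows "matrix_power (r *\<^sub>R A) k = r ^ k *\<^sub>R matrix_power A k"
  by (induction k) (simp_all add: scaleR_matrix_mult)

lemma matrix_power_add:
  fixes A :: "complex^'n^'n"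
  shows "matrix_power A (j + k) = matrix_power A j ** matrix_power A k"
  by (induction j) (simp_all add: matrix_mul_assoc)

lemma matrix_exp_sums:
  "(\<lambda>k. (1 / fact k) *\<^sub>R matrix_power A k) sums matrix_exp A"
  unfolding matrix_exp_def using summable_matrix_exp by (rule summable_sums)

lemma sums_matrixI:
  fixes f :: "nat \<Rightarrow> complex^'n^'n"
  assumes "\<And>i j. (\<lambda>k. f k $ i $ j) sums (S $ i $ j)"
  shows "f sums S"
  unfolding sums_def
proof (intro vec_tendstoI)
  fix i j
  show "(\<lambda>n. (\<Sum>k<n. f k) $ i $ j) \<longlonglongrightarrow> S $ i $ j"
    using assms[of i j] by (simp add: sums_def)
qed

text \<open>The Cauchy product requires absolute convergence; the entrywise bound on powers gives it
  by comparison with a scalar exponential series.\<close>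

lemma summable_norm_matrix_exp_entry:
  fixes A :: "complex^'n^'n"
  shows "summable (\<lambda>k. norm (((1 / fact k) *\<^sub>R matrix_power A k) $ i $ j))"
proof (rule summable_comparison_test')
  define b where "b = real CARD('n) * norm A"
  show "summable (\<lambda>k. inverse (fact k) * b ^ k)"
    by (rule summable_exp)
  show "norm (norm (((1 / fact k) *\<^sub>R matrix_power A k) $ i $ j)) \<le> inverse (fact k) * b ^ k" for k
    using norm_matrix_power_entry[of A k i j] by (simp add: b_def field_simps)
qed

text \<open>An entry of a matrix product is a finite sum of products of complex numbers, so the
  Cauchy product of absolutely convergent complex series applies for each inner index
  \<open>l\<close>.\<close>

lemma matrix_exp_Cauchy_product:
  fixes A B :: "complex^'n^'n"
  shows "(\<lambda>k. \<Sum>i\<le>k. ((1 / fact i) *\<^sub>R matrix_power A i) ** ((1 / fact (k - i)) *\<^sub>R matrix_power B (k - i)))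
    sums (matrix_exp A ** matrix_exp B)"
proof (rule sums_matrixI)
  fix p q
  define a where "a l i = ((1 / fact i) *\<^sub>R matrix_power A i) $ p $ l" for l i
  define b where "b l i = ((1 / fact i) *\<^sub>R matrix_power B i) $ l $ q" for l i
  have "(\<lambda>k. \<Sum>i\<le>k. a l i * b l (k - i)) sums (matrix_exp A $ p $ l * matrix_exp B $ l $ q)" for l
  proof -
    have "a l sums (matrix_exp A $ p $ l)" "b l sums (matrix_exp B $ l $ q)"
      unfolding a_def b_def by (intro sums_vec_nth matrix_exp_sums)+
    moreover have "(\<lambda>k. \<Sum>i\<le>k. a l i * b l (k - i)) sums ((\<Sum>k. a l k) * (\<Sum>k. b l k))"
      unfolding a_def b_def by (intro Cauchy_product_sums summable_norm_matrix_exp_entry)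
    ultimately show ?thesis by (simp add: sums_iff)
  qed
  then have "(\<lambda>k. \<Sum>l\<in>UNIV. \<Sum>i\<le>k. a l i * b l (k - i)) sums
      (\<Sum>l\<in>UNIV. matrix_exp A $ p $ l * matrix_exp B $ l $ q)"
    by (intro sums_sum) auto
  moreover have "(\<Sum>l\<in>UNIV. \<Sum>i\<le>k. a l i * b l (k - i)) = (\<Sum>i\<le>k. ((1 / fact i) *\<^sub>R matrix_power A i)
      ** ((1 / fact (k - i)) *\<^sub>R matrix_power B (k - i))) $ p $ q" for k
    unfolding a_def b_def
    by (subst sum.swap) (simp add: matrix_matrix_mult_def)
  ultimately show "(\<lambda>k. (\<Sum>i\<le>k. ((1 / fact i) *\<^sub>R matrix_power A i)
      ** ((1 / fact (k - i)) *\<^sub>R matrix_power B (k - i))) $ p $ q) sums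
      ((matrix_exp A ** matrix_exp B) $ p $ q)"
    by (simp add: matrix_matrix_mult_def)
qed

text \<open>Multiples of one matrix commute, so each Cauchy term reduces to a binomial sum times a
  power of \<open>A\<close>. Iterated, this turns powers of an exponential into an
  exponential.\<close>

lemma matrix_exp_scaleR_add:
  fixes A :: "complex^'n^'n"
  shows "matrix_exp ((r + s) *\<^sub>R A) = matrix_exp (r *\<^sub>R A) ** matrix_exp (s *\<^sub>R A)"
proof -
  have "(\<Sum>i\<le>k. ((1 / fact i) *\<^sub>R matrix_power (r *\<^sub>R A) i)
          ** ((1 / fact (k - i)) *\<^sub>R matrix_power (s *\<^sub>R A) (k - i)))
      = (1 / fact k) *\<^sub>R matrix_power ((r + s) *\<^sub>R A) k" for k
  proof -
    have "(\<Sum>i\<le>k. ((1 / fact i) *\<^sub>R matrix_power (r *\<^sub>R A) i)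
          ** ((1 / fact (k - i)) *\<^sub>R matrix_power (s *\<^sub>R A) (k - i)))
      = (\<Sum>i\<le>k. (r ^ i * s ^ (k - i) / (fact i * fact (k - i))) *\<^sub>R matrix_power A k)"
      by (intro sum.cong refl)
        (simp add: matrix_power_scaleR scaleR_matrix_mult mult.commute flip: matrix_power_add)
    also have "\<dots> = (\<Sum>i\<le>k. r ^ i * s ^ (k - i) / (fact i * fact (k - i))) *\<^sub>R matrix_power A k"
      by (simp add: scaleR_sum_left)
    also have "(\<Sum>i\<le>k. r ^ i * s ^ (k - i) / (fact i * fact (k - i))) = (r + s) ^ k / fact k"
      by (simp add: binomial_ring sum_divide_distrib binomial_fact)
    finally show ?thesis by (simp add: matrix_power_scaleR)
  qed
  then show ?thesis
    using matrix_exp_Cauchy_product[of "r *\<^sub>R A" "s *\<^sub>R A"] matrix_exp_sums[of "(r + s) *\<^sub>R A"]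
    by (simp add: sums_iff)
qed

lemma matrix_exp_0: "matrix_exp (0 :: complex^'n^'n) = mat 1"
proof -
  have "matrix_power (0 :: complex^'n^'n) k = 0" if "k \<noteq> 0" for k
    using that by (cases k) simp_all
  then have "(\<lambda>k. (1 / fact k) *\<^sub>R matrix_power (0 :: complex^'n^'n) k) sums
      (\<Sum>k\<in>{0}. (1 / fact k) *\<^sub>R matrix_power 0 k)"
    by (intro sums_finite) auto
  then show ?thesis
    using matrix_exp_sums[of "0 :: complex^'n^'n"] by (simp add: sums_iff)
qed

lemma matrix_power_matrix_exp:
  fixes A :: "complex^'n^'n"
  shows "matrix_power (matrix_exp A) k = matrix_exp (real k *\<^sub>R A)"
  by (induction k) (simp_all add: matrix_exp_0 matrix_exp_scaleR_add)

section \<open>Estimates in a submultiplicative norm\<close>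

context
  fixes N :: "complex^'n^'n \<Rightarrow> real"
  assumes N: "submultiplicative_matrix_norm N"
begin

lemma matrix_norm_nonneg: "0 \<le> N A"
  and matrix_norm_triangle: "N (A + B) \<le> N A + N B"
  and matrix_norm_mult_le: "N (A ** B) \<le> N A * N B"
  and matrix_norm_mat_1: "N (mat 1) = 1"
  using N by (auto simp: submultiplicative_matrix_norm_def)

lemma matrix_norm_scaleR: "N (r *\<^sub>R A) = \<bar>r\<bar> * N A"
proof -
  \<comment> \<open>Homogeneity is assumed for complex scalars; a real scalar is embedded into
    them.\<close>
  have "r *\<^sub>R A = map_matrix ((*) (complex_of_real r)) A"
    by (simp add: vec_eq_iff map_matrix_def) (simp add: scaleR_conv_of_real)
  then show ?thesis
    using N by (simp add: submultiplicative_matrix_norm_def)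
qed

lemma matrix_norm_zero: "N 0 = 0"
  using matrix_norm_scaleR[of 0 0] by simp

lemma matrix_norm_minus: "N (A - B) \<le> N A + N B"
  using matrix_norm_triangle[of A "(- 1) *\<^sub>R B"] matrix_norm_scaleR[of "- 1" B] by simp

lemma matrix_norm_mult_bound:
  assumes "N A \<le> a" "N B \<le> b"
  shows "N (A ** B) \<le> a * b"
  using matrix_norm_mult_le[of A B] mult_mono[OF assms order_trans[OF matrix_norm_nonneg assms(1)] matrix_norm_nonneg] by linarith

lemma matrix_norm_power_bound:
  assumes "N A \<le> a"
  shows "N (matrix_power A k) \<le> a ^ k"
  by (induction k) (simp_all add: matrix_norm_mat_1 matrix_norm_mult_bound assms)

lemma matrix_norm_sum_bound: "N (sum f I) \<le> (\<Sum>i\<in>I. N (f i))"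
proof (induction I rule: infinite_finite_induct)
  case (insert x F)
  then show ?case using matrix_norm_triangle[of "f x" "sum f F"] by simp
qed (simp_all add: matrix_norm_zero)

text \<open>The exponential series converges in the standard topology, while the estimates are in
  \<open>N\<close>. A norm is convex, and convex functions on a finite-dimensional space are
  continuous, which links the two.\<close>

lemma matrix_norm_continuous: "continuous_on UNIV N"
proof (rule convex_on_continuous)
  show "convex_on UNIV N"
  proof (rule convex_onI)
    fix t :: real and A B
    assume "0 < t" "t < 1"
    then show "N ((1 - t) *\<^sub>R A + t *\<^sub>R B) \<le> (1 - t) * N A + t * N B"
      using matrix_norm_triangle[of "(1 - t) *\<^sub>R A" "t *\<^sub>R B"] by (simp add: matrix_norm_scaleR)
  qed simp
qed simp

lemma matrix_norm_sums_bound: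
  assumes "f sums S" "g sums T" "\<And>k. N (f k) \<le> g k"
  shows "N S \<le> T"
proof (rule LIMSEQ_le)
  show "(\<lambda>n. N (\<Sum>k<n. f k)) \<longlonglongrightarrow> N S"
    using assms(1) by (intro continuous_on_tendsto_compose[OF matrix_norm_continuous]) (auto simp: sums_def)
  show "(\<lambda>n. \<Sum>k<n. g k) \<longlonglongrightarrow> T"
    using assms(2) by (simp add: sums_def)
  show "\<exists>m. \<forall>n\<ge>m. N (\<Sum>k<n. f k) \<le> (\<Sum>k<n. g k)"
    by (intro exI allI impI order_trans[OF matrix_norm_sum_bound] sum_mono assms(3))
qed

text \<open>The tail of the matrix series from index \<open>m\<close> on is dominated termwise by
  the tail of the series of \<open>exp a\<close>, since \<open>N (matrix_power A k)\<close> is at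
  most \<open>a ^ k\<close>.\<close>

lemma matrix_exp_remainder_bound:
  assumes "N A \<le> a"
  shows "N (matrix_exp A - (\<Sum>k<m. (1 / fact k) *\<^sub>R matrix_power A k)) \<le> exp a - (\<Sum>k<m. a ^ k / fact k)"
proof (rule matrix_norm_sums_bound)
  show "(\<lambda>k. (1 / fact (k + m)) *\<^sub>R matrix_power A (k + m)) sums
      (matrix_exp A - (\<Sum>k<m. (1 / fact k) *\<^sub>R matrix_power A k))"
    by (rule sums_split_initial_segment[OF matrix_exp_sums])
  have "(\<lambda>k. a ^ k / fact k) sums exp a"
    using exp_converges[of a] by (simp add: divide_inverse mult.commute)
  then show "(\<lambda>k. a ^ (k + m) / fact (k + m)) sums (exp a - (\<Sum>k<m. a ^ k / fact k))"
    by (rule sums_split_initial_segment)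
  show "N ((1 / fact (k + m)) *\<^sub>R matrix_power A (k + m)) \<le> a ^ (k + m) / fact (k + m)" for k
    using matrix_norm_power_bound[OF assms, of "k + m"] by (simp add: matrix_norm_scaleR divide_right_mono)
qed

lemma matrix_exp_bounds:
  assumes "N A \<le> a"
  shows "N (matrix_exp A) \<le> exp a"
    and "N (matrix_exp A - mat 1) \<le> exp a - 1"
    and "N (matrix_exp A - mat 1 - A) \<le> exp a - 1 - a"
  \<comment> \<open>Cutting at 0, 1 and 2 removes nothing, \<open>mat 1\<close>, and
    \<open>mat 1 + A\<close> respectively.\<close>
  using matrix_exp_remainder_bound[OF assms, of 0] matrix_exp_remainder_bound[OF assms, of 1]
    matrix_exp_remainder_bound[OF assms, of 2]
  by (simp_all add: numeral_2_eq_2 diff_diff_eq)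

lemma matrix_exp_product_bounds:
  assumes "N A \<le> s" "N B \<le> s" "N C \<le> s"
  shows "N (matrix_exp A ** matrix_exp B ** matrix_exp C) \<le> exp (3 * s)"
    and "N (matrix_exp A ** matrix_exp B ** matrix_exp C - mat 1 - (A + B + C)) \<le> exp (3 * s) - 1 - 3 * s"
proof -
  let ?A = "matrix_exp A" and ?B = "matrix_exp B" and ?C = "matrix_exp C"
  have e3: "exp (3 * s) = exp s * exp s * exp s"
    by (simp flip: exp_add)
  show "N (?A ** ?B ** ?C) \<le> exp (3 * s)"
    unfolding e3 by (intro matrix_norm_mult_bound matrix_exp_bounds assms)
  \<comment> \<open>With a, b, c the three exponentials, \<open>P\<close>, \<open>Q\<close>,
    \<open>R\<close> collect the products of at least two of a - 1, b - 1, c - 1: the middle factor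
    b = 1 + (b - 1) lets \<open>P\<close> cover both the outer pair and the triple product.
    \<open>S\<close> holds the single remainders.\<close>
  define P where "P = (?A - mat 1) ** ?B ** (?C - mat 1)"
  define Q where "Q = (?A - mat 1) ** (?B - mat 1)"
  define R where "R = (?B - mat 1) ** (?C - mat 1)"
  define S where "S = (?A - mat 1 - A) + (?B - mat 1 - B) + (?C - mat 1 - C)"
  have eq: "?A ** ?B ** ?C - mat 1 - (A + B + C) = P + Q + R + S"
    by (simp add: P_def Q_def R_def S_def matrix_mult_diff)
  have "N P \<le> (exp s - 1) * exp s * (exp s - 1)"
    unfolding P_def by (intro matrix_norm_mult_bound matrix_exp_bounds assms)
  moreover have "N Q \<le> (exp s - 1) * (exp s - 1)"
    unfolding Q_def by (intro matrix_norm_mult_bound matrix_exp_bounds assms)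
  moreover have "N R \<le> (exp s - 1) * (exp s - 1)"
    unfolding R_def by (intro matrix_norm_mult_bound matrix_exp_bounds assms)
  moreover have "N S \<le> (exp s - 1 - s) + (exp s - 1 - s) + (exp s - 1 - s)"
    unfolding S_def by (intro order_trans[OF matrix_norm_triangle] add_mono matrix_exp_bounds assms)
  moreover have "N (P + Q + R + S) \<le> N P + N Q + N R + N S"
    by (intro order_trans[OF matrix_norm_triangle] add_mono order_refl)
  ultimately have "N (P + Q + R + S) \<le> (exp s - 1) * exp s * (exp s - 1)
      + (exp s - 1) * (exp s - 1) + (exp s - 1) * (exp s - 1)
      + ((exp s - 1 - s) + (exp s - 1 - s) + (exp s - 1 - s))"
    by linarith
  \<comment> \<open>The same decomposition, read for three scalar factors \<open>exp s\<close>, so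
    the termwise bounds add up exactly.\<close>
  also have "\<dots> = exp (3 * s) - 1 - 3 * s"
    unfolding e3 by (simp add: algebra_simps)
  finally show "N (?A ** ?B ** ?C - mat 1 - (A + B + C)) \<le> exp (3 * s) - 1 - 3 * s"
    unfolding eq .
qed

text \<open>Exchanging \<open>X\<close> for \<open>Y\<close> one factor at a time gives
  \<open>Suc k\<close> terms, each with one factor \<open>X - Y\<close> and \<open>k\<close> factors
  bounded by \<open>m\<close>. The exponent \<open>Suc k\<close> avoids a truncated subtraction in
  \<open>m ^ k\<close>.\<close>

lemma matrix_norm_power_diff_bound:
  assumes "N X \<le> m" "N Y \<le> m"
  shows "N (matrix_power X (Suc k) - matrix_power Y (Suc k)) \<le> real (Suc k) * N (X - Y) * m ^ k"
proof (induction k)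
  case 0
  then show ?case by simp
next
  case (Suc k)
  let ?p = "matrix_power X (Suc k)" and ?q = "matrix_power Y (Suc k)"
  have eq: "X ** ?p - Y ** ?q = X ** (?p - ?q) + (X - Y) ** ?q"
    by (simp add: matrix_mult_diff del: matrix_power.simps)
  have "N (X ** (?p - ?q)) \<le> m * (real (Suc k) * N (X - Y) * m ^ k)"
    by (rule matrix_norm_mult_bound[OF assms(1) Suc.IH])
  moreover have "N ((X - Y) ** ?q) \<le> N (X - Y) * m ^ Suc k"
    by (rule matrix_norm_mult_bound[OF order_refl matrix_norm_power_bound[OF assms(2)]])
  ultimately have "N (X ** ?p - Y ** ?q)
      \<le> m * (real (Suc k) * N (X - Y) * m ^ k) + N (X - Y) * m ^ Suc k"
    unfolding eq using matrix_norm_triangle[of "X ** (?p - ?q)" "(X - Y) ** ?q"] by linarith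
  then show ?case by (simp add: algebra_simps)
qed

end

text \<open>Taylor's formula with Lagrange remainder at order two. The factor 2 is there because
  \<open>X\<close> and \<open>Y\<close> each contribute one such remainder.\<close>

lemma exp_second_remainder_le:
  fixes t :: real
  assumes "0 \<le> t"
  shows "2 * (exp t - 1 - t) \<le> t\<^sup>2 * exp t"
proof -
  obtain x where x: "\<bar>x\<bar> \<le> \<bar>t\<bar>" and eq: "exp t = (\<Sum>m<2. t ^ m / fact m) + exp x / fact 2 * t ^ 2"
    using Maclaurin_exp_le[of t 2] by blast
  from x have "exp x \<le> exp t"
    using assms by simp
  then have "exp x * t\<^sup>2 \<le> exp t * t\<^sup>2"
    by (rule mult_right_mono) simp
  moreover have "2 * exp t = 2 * (1 + t) + exp x * t\<^sup>2"
    by (subst eq) (simp add: numeral_2_eq_2)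
  moreover have "exp t * t\<^sup>2 = t\<^sup>2 * exp t"
    by (rule mult.commute)
  ultimately show ?thesis
    by argo
qed

theorem proposition5p3:
  fixes N :: "complex^'n^'n \<Rightarrow> real"
    and A\<^sub>1 A\<^sub>2 A\<^sub>3 :: "complex^'n^'n"
    and \<alpha> :: real
    and n :: nat
  assumes "submultiplicative_matrix_norm N"
    and "\<alpha> \<ge> 0"
    and "N A\<^sub>1 \<le> \<alpha> / 3" and "N A\<^sub>2 \<le> \<alpha> / 3" and "N A\<^sub>3 \<le> \<alpha> / 3"
    and "n \<ge> 1"
  shows "N (matrix_power
              (matrix_exp ((1 / real n) *\<^sub>R A\<^sub>1) ** matrix_exp ((1 / real n) *\<^sub>R A\<^sub>2)
                 ** matrix_exp ((1 / real n) *\<^sub>R A\<^sub>3)) n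
            - matrix_exp (A\<^sub>1 + A\<^sub>2 + A\<^sub>3))
         \<le> (\<alpha>\<^sup>2 * exp (2 * \<alpha>)) / real n"
proof -
  note N = assms(1)
  define t where "t = \<alpha> / real n"
  define B\<^sub>1 B\<^sub>2 B\<^sub>3 where "B\<^sub>1 = (1 / real n) *\<^sub>R A\<^sub>1" and "B\<^sub>2 = (1 / real n) *\<^sub>R A\<^sub>2"
    and "B\<^sub>3 = (1 / real n) *\<^sub>R A\<^sub>3"
  define B where "B = B\<^sub>1 + B\<^sub>2 + B\<^sub>3"
  define X where "X = matrix_exp B\<^sub>1 ** matrix_exp B\<^sub>2 ** matrix_exp B\<^sub>3"
  define Y where "Y = matrix_exp B"
  have n: "real n > 0" and t: "t \<ge> 0" using assms by (simp_all add: t_def)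
  have B_le: "N B\<^sub>1 \<le> t / 3" "N B\<^sub>2 \<le> t / 3" "N B\<^sub>3 \<le> t / 3"
    using assms(3-5) n by (simp_all add: B\<^sub>1_def B\<^sub>2_def B\<^sub>3_def t_def matrix_norm_scaleR[OF N] field_simps)
  then have "N B \<le> t"
    using matrix_norm_triangle[OF N, of "B\<^sub>1 + B\<^sub>2" B\<^sub>3] matrix_norm_triangle[OF N, of B\<^sub>1 B\<^sub>2] by (simp add: B_def)
  note Y = matrix_exp_bounds[OF N this, folded Y_def]
  \<comment> \<open>The product bounds are used with \<open>s = t / 3\<close>, so that
    \<open>3 * s\<close> is \<open>t\<close> and \<open>X\<close> obeys the same bounds as
    \<open>Y\<close>.\<close>
  have X: "N X \<le> exp t" "N (X - mat 1 - B) \<le> exp t - 1 - t"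
    using matrix_exp_product_bounds[OF N B_le] by (simp_all add: X_def B_def)
  \<comment> \<open>The common first-order part \<open>mat 1 + B\<close> cancels in the
    difference.\<close>
  have "N (X - Y) = N ((X - mat 1 - B) - (Y - mat 1 - B))" by simp
  also have "\<dots> \<le> (exp t - 1 - t) + (exp t - 1 - t)"
    using matrix_norm_minus[OF N, of "X - mat 1 - B" "Y - mat 1 - B"] X(2) Y(3) by linarith
  also have "\<dots> \<le> t\<^sup>2 * exp t"
    using exp_second_remainder_le[OF t] by simp
  finally have XY: "N (X - Y) \<le> t\<^sup>2 * exp t" .
  obtain k where k: "n = Suc k" using assms(6) by (cases n) auto
  have "real n *\<^sub>R B = A\<^sub>1 + A\<^sub>2 + A\<^sub>3"
    using n by (simp add: B_def B\<^sub>1_def B\<^sub>2_def B\<^sub>3_def scaleR_add_right)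
  then have Yn: "matrix_power Y n = matrix_exp (A\<^sub>1 + A\<^sub>2 + A\<^sub>3)"
    by (simp add: Y_def matrix_power_matrix_exp)
  have "N (matrix_power X n - matrix_power Y n) \<le> real n * N (X - Y) * exp t ^ k"
    unfolding k by (rule matrix_norm_power_diff_bound[OF N X(1) Y(1)])
  also have "\<dots> \<le> real n * (t\<^sup>2 * exp t) * exp t ^ k"
    using XY by (intro mult_right_mono mult_left_mono) auto
  \<comment> \<open>The factor \<open>exp t\<close> from the bound on \<open>X - Y\<close> completes
    \<open>exp t ^ k\<close> to the full power \<open>n = Suc k\<close>.\<close>
  also have "\<dots> = real n * t\<^sup>2 * exp t ^ n"
    by (simp add: k)
  also have "exp t ^ n = exp \<alpha>"
    using n by (simp add: t_def flip: exp_of_nat_mult)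
  also have "real n * t\<^sup>2 * exp \<alpha> = \<alpha>\<^sup>2 * exp \<alpha> / real n"
    using n by (simp add: t_def power2_eq_square)
  \<comment> \<open>The argument yields the constant \<open>\<alpha>\<^sup>2 * exp \<alpha>\<close>;
    as \<alpha> is nonnegative, it is at most the claimed one.\<close>
  also have "\<dots> \<le> \<alpha>\<^sup>2 * exp (2 * \<alpha>) / real n"
    using assms(2) by (intro divide_right_mono mult_left_mono) auto
  finally show ?thesis
    unfolding Yn by (simp add: X_def B\<^sub>1_def B\<^sub>2_def B\<^sub>3_def)
qed

end
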